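(* Let $a$ be an integral closed 2-frieze of width $m$ and let $b$ be an integral closed 2-frieze of width $\ell$. Let $c,d\in\mathbb{Z}$, and consider the two consecutive columns $c,c+1$ of $a$ and the two consecutive columns $d,d+1$ of $b$. Gluing the first pair of columns on top of the second pair over the pair $1\;1$ (the bottom $1\;1$ of the columns of $a$ being identified with the top $1\;1$ of the columns of $b$) leads to an integral closed 2-frieze of width $m+\ell+1$. That is, there is an integral closed 2-frieze $w$ of width $m+\ell+1$ such that, for $\epsilon\in\{0,1\}$, $$w(r,\epsilon)=a(r,c+\epsilon)\ \text{ for } 0\le r\le m+1,\qquad w(m+1+r,\epsilon)=b(r,d+\epsilon)\ \text{ for } 0\le r\le \ell+1 .$$
   Context: A closed 2-frieze of width $m\ge 0$ is an array $a(r,c)$, with rows $r\in\{0,1,\dots,m+1\}$ (numbered from top to bottom) and columns $c\in\mathbb{Z}$ (numbered from left to right), whose top and bottom rows consist of 1s, i.e. $a(0,c)=a(m+1,c)=1$ for all $c\in\mathbb{Z}$, and which satisfies the local rule $$a(r,c)=a(r,c-1)\,a(r,c+1)-a(r-1,c)\,a(r+1,c)\qquad (1\le r\le m,\ c\in\mathbb{Z}).$$ A closed 2-frieze is integral if all its entries are positive integers. *)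

theory Defs
  imports Main
begin

text \<open>
  An array is a function \<open>a\<close> with \<open>a r c\<close> the entry in row \<open>r\<close> and column \<open>c\<close>. Only the rows
  \<open>0, \<dots>, m + 1\<close> belong to a frieze of width \<open>m\<close>; all other values of the function are irrelevant.
\<close>

definition closed_2frieze :: "nat \<Rightarrow> (nat \<Rightarrow> int \<Rightarrow> 'a::comm_ring_1) \<Rightarrow> bool" where
  "closed_2frieze m a \<longleftrightarrow>
     (\<forall>c. a 0 c = 1) \<and> (\<forall>c. a (m + 1) c = 1) \<and>
     (\<forall>r c. 1 \<le> r \<and> r \<le> m \<longrightarrow>
        a r c = a r (c - 1) * a r (c + 1) - a (r - 1) c * a (r + 1) c)"

definition integral_closed_2frieze :: "nat \<Rightarrow> (nat \<Rightarrow> int \<Rightarrow> int) \<Rightarrow> bool" where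
  "integral_closed_2frieze m a \<longleftrightarrow>
     closed_2frieze m a \<and> (\<forall>r c. r \<le> m + 1 \<longrightarrow> a r c > 0)"

end

theory Submission
  imports Complex_Main Defs
begin

text \<open>
  Two consecutive positive columns determine a positive rational 2-frieze, so only the integrality
  of the glued frieze \<open>w\<close> is at stake. Extended by two rows of zeros on either side, a positive
  2-frieze satisfies, along each diagonal, a linear recurrence of order three whose coefficients
  are entries of row \<open>1\<close>. Hence \<open>w\<close> is integral as soon as its row \<open>1\<close> is, and the zero rows force
  the glide symmetry \<open>w 1 (c + n + 4) = w n c\<close>. It therefore suffices to find \<open>2 (n + 4)\<close> integers
  suitably placed in the rows \<open>1\<close> and \<open>n\<close>. Most of these entries are entries of \<open>a\<close> or of \<open>b\<close>, by
  domain of dependence; the others are reached from integral entries next to the glued pair \<open>1 1\<close>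
  by running the recurrence backwards.
\<close>

section \<open>Positive 2-friezes over an ordered field: symmetries, diagonal recurrence,
  periodicity\<close>

locale positive_2frieze =
  fixes n :: int and w :: "int \<Rightarrow> int \<Rightarrow> 'a::linordered_field"
  assumes width: "0 \<le> n"
    and inner_rule: "\<lbrakk>1 \<le> r; r \<le> n\<rbrakk> \<Longrightarrow> w r c = w r (c - 1) * w r (c + 1) - w (r - 1) c * w (r + 1) c"
    and pos: "\<lbrakk>0 \<le> r; r \<le> n + 1\<rbrakk> \<Longrightarrow> 0 < w r c"
    and top: "w 0 c = 1" and bottom: "w (n + 1) c = 1"
    and zero_above: "w (-1) c = 0" "w (-2) c = 0"
    and zero_below: "w (n + 2) c = 0" "w (n + 3) c = 0"
begin

lemma bottom': "w (1 + n) c = 1"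
  using bottom by (simp add: add.commute)

text \<open>The border of ones and the two zero rows on each side satisfy the local rule trivially.
  This lets the recurrence start at the top and run on into row \<open>n + 3\<close>.\<close>

lemma rule:
  assumes "-1 \<le> r" "r \<le> n + 2"
  shows "w r c = w r (c - 1) * w r (c + 1) - w (r - 1) c * w (r + 1) c"
proof -
  consider "r = -1" | "r = 0" | "1 \<le> r" "r \<le> n" | "r = n + 1" | "r = n + 2"
    using assms by linarith
  then show ?thesis
  proof cases
    case 3
    then show ?thesis by (rule inner_rule)
  qed (simp_all add: top bottom bottom' zero_above zero_below add.commute)
qed

lemma mirror: "positive_2frieze n (\<lambda>r c. w r (k - c))"
proof
  fix r c :: int
  assume "1 \<le> r" "r \<le> n"
  then show "w r (k - c) = w r (k - (c - 1)) * w r (k - (c + 1)) - w (r - 1) (k - c) * w (r + 1) (k - c)"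
    using inner_rule[of r "k - c"] by (simp add: algebra_simps)
qed (simp_all add: width pos top bottom zero_above zero_below)

lemma flip: "positive_2frieze n (\<lambda>r c. w (n + 1 - r) c)"
proof
  fix r c :: int
  assume "1 \<le> r" "r \<le> n"
  then show "w (n + 1 - r) c = w (n + 1 - r) (c - 1) * w (n + 1 - r) (c + 1)
      - w (n + 1 - (r - 1)) c * w (n + 1 - (r + 1)) c"
    using inner_rule[of "n + 1 - r" c] by (simp add: algebra_simps)
qed (use zero_above zero_below bottom in \<open>simp_all add: width pos top add.commute\<close>)

text \<open>Multiplied by \<open>w (r - 1) c\<close>, the claim follows by polynomial elimination
  from the local rule at four successive entries of one diagonal and the recurrences for rows
  \<open>r - 1\<close> and \<open>r\<close>. The factor lies in a row between \<open>1\<close> and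
  \<open>n + 1\<close>, so it is positive and cancels.\<close>

lemma recurrence_step:
  assumes "2 \<le> r" "r \<le> n + 2"
    and rec1: "\<And>c. w (r - 1) c = w 1 (c + r - 2) * w (r - 2) (c - 1)
               - w 1 (c + r - 3) * w (r - 3) (c - 2) + w (r - 4) (c - 3)"
    and rec: "\<And>c. w r c = w 1 (c + r - 1) * w (r - 1) (c - 1)
               - w 1 (c + r - 2) * w (r - 2) (c - 2) + w (r - 3) (c - 3)"
  shows "w (r + 1) c = w 1 (c + r) * w r (c - 1)
               - w 1 (c + r - 1) * w (r - 1) (c - 2) + w (r - 2) (c - 3)"
proof -
  define p q s t where "p = w 1 (c + r)" and "q = w 1 (c + r - 1)"
    and "s = w 1 (c + r - 2)" and "t = w 1 (c + r - 3)"
  have r0: "w (r + 1) c * w (r - 1) c = w r (c - 1) * w r (c + 1) - w r c"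
    using rule[of r c] assms(1,2) by (simp add: algebra_simps)
  have r1: "w (r - 1) (c - 1) = w (r - 1) (c - 2) * w (r - 1) c - w (r - 2) (c - 1) * w r (c - 1)"
    using rule[of "r - 1" "c - 1"] assms(1,2) by (simp add: algebra_simps)
  have r2: "w (r - 2) (c - 2) = w (r - 2) (c - 3) * w (r - 2) (c - 1) - w (r - 3) (c - 2) * w (r - 1) (c - 2)"
    using rule[of "r - 2" "c - 2"] assms(1,2) by (simp add: algebra_simps)
  have r3: "w (r - 3) (c - 3) = w (r - 3) (c - 4) * w (r - 3) (c - 2) - w (r - 4) (c - 3) * w (r - 2) (c - 3)"
    using rule[of "r - 3" "c - 3"] assms(1,2) by (simp add: algebra_simps)
  have e1: "w r (c + 1) = p * w (r - 1) c - q * w (r - 2) (c - 1) + w (r - 3) (c - 2)"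
    using rec[of "c + 1"] by (simp add: p_def q_def algebra_simps)
  have e2: "w r c = q * w (r - 1) (c - 1) - s * w (r - 2) (c - 2) + w (r - 3) (c - 3)"
    using rec[of c] by (simp add: s_def q_def)
  have e3: "w r (c - 1) = s * w (r - 1) (c - 2) - t * w (r - 2) (c - 3) + w (r - 3) (c - 4)"
    using rec[of "c - 1"] by (simp add: s_def t_def algebra_simps)
  have e4: "w (r - 1) c = s * w (r - 2) (c - 1) - t * w (r - 3) (c - 2) + w (r - 4) (c - 3)"
    using rec1[of c] by (simp add: s_def t_def)
  have "w (r + 1) c * w (r - 1) c = (p * w r (c - 1) - q * w (r - 1) (c - 2) + w (r - 2) (c - 3)) * w (r - 1) c"
    using r0 r1 r2 r3 e1 e2 e3 e4 by algebra
  moreover have "w (r - 1) c \<noteq> 0"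
    using pos[of "r - 1" c] assms(1,2) by simp
  ultimately show ?thesis
    by (simp add: p_def q_def)
qed

lemma recurrence:
  assumes "1 \<le> r" "r \<le> n + 3"
  shows "w r c = w 1 (c + r - 1) * w (r - 1) (c - 1)
               - w 1 (c + r - 2) * w (r - 2) (c - 2) + w (r - 3) (c - 3)"
proof -
  define R where "R r = (\<forall>c. w r c = w 1 (c + r - 1) * w (r - 1) (c - 1)
               - w 1 (c + r - 2) * w (r - 2) (c - 2) + w (r - 3) (c - 3))" for r
  \<comment> \<open>\<open>recurrence_step\<close> consumes two consecutive rows, so the induction
    carries a pair; the last row \<open>n + 3\<close> is the second member of the pair at
    \<open>n + 2\<close>.\<close>
  have R: "r \<le> n + 2 \<longrightarrow> R r \<and> R (r + 1)" if "1 \<le> r" for r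
    using that
  proof (induction r rule: int_ge_induct)
    case base
    have "w 2 c = w 1 (c + 1) * w 1 (c - 1) - w 1 c" for c
      using rule[of 1 c] width by (simp add: top mult.commute)
    then show ?case
      by (simp add: R_def top zero_above add.commute)
  next
    case (step r)
    show ?case
    proof
      assume le: "r + 1 \<le> n + 2"
      then have IH: "R r" "R (r + 1)"
        using step by auto
      have "w (r + 2) c = w 1 (c + (r + 1)) * w (r + 1) (c - 1)
               - w 1 (c + (r + 1) - 1) * w r (c - 2) + w (r - 1) (c - 3)" for c
        using recurrence_step[of "r + 1" c] IH step.hyps le by (simp add: R_def algebra_simps)
      then have "R (r + 2)"
        by (simp add: R_def algebra_simps)
      with IH show "R (r + 1) \<and> R (r + 1 + 1)"
        by (simp add: add.assoc)
    qed
  qed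
  have "R r"
    using R[of r] R[of "n + 2"] assms width by (cases "r = n + 3") (auto simp: add.commute)
  then show ?thesis
    by (simp add: R_def)
qed

lemma recurrence_mirror:
  assumes "1 \<le> r" "r \<le> n + 3"
  shows "w r c = w 1 (c - r + 1) * w (r - 1) (c + 1)
               - w 1 (c - r + 2) * w (r - 2) (c + 2) + w (r - 3) (c + 3)"
proof -
  interpret M: positive_2frieze n "\<lambda>r c. w r (0 - c)"
    by (rule mirror)
  show ?thesis
    using M.recurrence[OF assms, of "- c"] by (simp add: algebra_simps)
qed

text \<open>In the recurrence for row \<open>n + 3\<close> the entries in rows \<open>n + 3\<close>
  and \<open>n + 2\<close> vanish and the one in row \<open>n + 1\<close> is 1, so only these two
  terms survive.\<close>

lemma glide: "w 1 (c + n + 4) = w n c"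
  using recurrence[of "n + 3" "c + 3"] width by (simp add: bottom' zero_below algebra_simps)

text \<open>One glide leads from row \<open>1\<close> to row \<open>n\<close>; the glide of the
  flipped frieze leads back.\<close>

lemma row_1_periodic: "w 1 (c + 2 * (n + 4)) = w 1 c"
proof -
  interpret F: positive_2frieze n "\<lambda>r c. w (n + 1 - r) c"
    by (rule flip)
  show ?thesis
    using glide[of "c + n + 4"] F.glide[of c] by (simp add: algebra_simps)
qed

lemma row_1_periodic_mult: "w 1 (c + 2 * (n + 4) * k) = w 1 c"
proof (induction k rule: int_induct[where k = 0])
  case (step1 i)
  then show ?case
    using row_1_periodic[of "c + 2 * (n + 4) * i"] by (simp add: algebra_simps)
next
  case (step2 i)
  then show ?case
    using row_1_periodic[of "c + 2 * (n + 4) * (i - 1)"] by (simp add: algebra_simps)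
qed simp

text \<open>The recurrence computes each row from the three rows above it and row \<open>1\<close>
  without division.\<close>

lemma integral_if_row_1_integral:
  assumes "\<And>c. w 1 c \<in> \<int>" "-2 \<le> r" "r \<le> n + 3"
  shows "w r c \<in> \<int>"
  using assms(2,3)
proof (induction "nat (r + 2)" arbitrary: r c rule: less_induct)
  case less
  consider "r = -2" | "r = -1" | "r = 0" | "1 \<le> r"
    using less.prems by linarith
  then show ?case
  proof cases
    case 4
    then have "w (r - 1) c' \<in> \<int>" "w (r - 2) c' \<in> \<int>" "w (r - 3) c' \<in> \<int>" for c'
      using less by simp_all
    then show ?thesis
      by (subst recurrence) (use 4 less.prems assms(1) in auto)
  qed (simp_all add: top zero_above)
qed

lemma integral_if_period_integral:
  assumes "\<And>c. \<lbrakk>p \<le> c; c < p + 2 * (n + 4)\<rbrakk> \<Longrightarrow> w 1 c \<in> \<int>" "-2 \<le> r" "r \<le> n + 3"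
  shows "w r c \<in> \<int>"
proof (rule integral_if_row_1_integral)
  fix c
  let ?N = "2 * (n + 4)"
  have "p + (c - p) mod ?N + ?N * ((c - p) div ?N) = c"
    by simp
  then have "w 1 c = w 1 (p + (c - p) mod ?N)"
    using row_1_periodic_mult[of "p + (c - p) mod ?N" "(c - p) div ?N"] by simp
  also have "\<dots> \<in> \<int>"
    using width by (intro assms(1)) simp_all
  finally show "w 1 c \<in> \<int>" .
qed fact+

end

section \<open>The glued frieze: entries inherited from \<open>a\<close> and \<open>b\<close>, and
  integrality of row \<open>1\<close>\<close>

locale glued_2frieze =
  A: positive_2frieze m a + B: positive_2frieze l b + W: positive_2frieze "m + l + 1" w
  for m l :: int and a b w :: "int \<Rightarrow> int \<Rightarrow> 'a::linordered_field" +
  assumes a_integral: "a r c \<in> \<int>" and b_integral: "b r c \<in> \<int>"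
    and glue_a: "\<lbrakk>0 \<le> r; r \<le> m + 1; e \<in> {0, 1}\<rbrakk> \<Longrightarrow> w r e = a r e"
    and glue_b: "\<lbrakk>0 \<le> r; r \<le> l + 1; e \<in> {0, 1}\<rbrakk> \<Longrightarrow> w (m + 1 + r) e = b r e"
begin

text \<open>The reflection \<open>1 - c\<close> swaps the glued columns \<open>0\<close> and
  \<open>1\<close>.\<close>

lemma mirror: "glued_2frieze m l (\<lambda>r c. a r (1 - c)) (\<lambda>r c. b r (1 - c)) (\<lambda>r c. w r (1 - c))"
  by (intro glued_2frieze.intro A.mirror B.mirror W.mirror glued_2frieze_axioms.intro
        a_integral b_integral glue_a glue_b) auto

text \<open>Turning everything upside down exchanges \<open>a\<close> and \<open>b\<close>, so
  results about the upper part transfer to the lower one.\<close>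

lemma flip: "glued_2frieze l m (\<lambda>r c. b (l + 1 - r) c) (\<lambda>r c. a (m + 1 - r) c)
    (\<lambda>r c. w (m + l + 2 - r) c)"
proof (intro glued_2frieze.intro A.flip B.flip glued_2frieze_axioms.intro a_integral b_integral)
  show "positive_2frieze (l + m + 1) (\<lambda>r c. w (m + l + 2 - r) c)"
    using W.flip by (simp add: algebra_simps)
  show "w (m + l + 2 - r) e = b (l + 1 - r) e" if "0 \<le> r" "r \<le> l + 1" "e \<in> {0, 1}" for r e
    using glue_b[of "l + 1 - r" e] that by (simp add: algebra_simps)
  show "w (m + l + 2 - (l + 1 + r)) e = a (m + 1 - r) e" if "0 \<le> r" "r \<le> m + 1" "e \<in> {0, 1}" for r e
    using glue_a[of "m + 1 - r" e] that by (simp add: algebra_simps)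
qed

text \<open>Domain of dependence: solving the local rule for the right-hand entry uses the row below
  in the previous column, so from column \<open>1\<close> on each step to the right loses one row at
  the bottom. The induction carries two consecutive columns.\<close>

lemma eq_a_right:
  assumes "0 \<le> c" "0 \<le> r" "r \<le> m + 1" "r + c \<le> m + 2"
  shows "w r c = a r c"
proof -
  define P where "P c = (\<forall>r. 0 \<le> r \<and> r \<le> m + 1 \<and> r + c \<le> m + 2 \<longrightarrow> w r c = a r c)" for c
  have "P c \<and> P (c + 1)"
    using \<open>0 \<le> c\<close>
  proof (induction c rule: int_ge_induct)
    case base
    then show ?case
      using glue_a by (simp add: P_def)
  next
    case (step c)
    have "w r (c + 2) = a r (c + 2)" if r: "0 \<le> r" "r + (c + 2) \<le> m + 2" for r
    proof (cases "r = 0")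
      case False
      have w: "w r (c + 1) = w r c * w r (c + 2) - w (r - 1) (c + 1) * w (r + 1) (c + 1)"
        using W.rule[of r "c + 1"] r False step.hyps B.width by (simp add: algebra_simps)
      have a: "a r (c + 1) = a r c * a r (c + 2) - a (r - 1) (c + 1) * a (r + 1) (c + 1)"
        using A.rule[of r "c + 1"] r False step.hyps by (simp add: algebra_simps)
      have "w r c = a r c" "w r (c + 1) = a r (c + 1)"
        "w (r - 1) (c + 1) = a (r - 1) (c + 1)" "w (r + 1) (c + 1) = a (r + 1) (c + 1)"
        using step r False by (simp_all add: P_def)
      then have "a r c * w r (c + 2) = a r c * a r (c + 2)"
        using w a by (simp only: diff_left_imp_eq)
      moreover have "a r c \<noteq> 0"
        using A.pos[of r c] r step.hyps by simp
      ultimately show ?thesis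
        by (metis mult_left_cancel)
    qed (simp add: A.top W.top)
    then show ?case
      using step by (simp add: P_def add.assoc)
  qed
  then show ?thesis
    using assms by (simp add: P_def)
qed

lemma eq_a:
  assumes "0 \<le> r" "r \<le> m + 1" "r - m - 1 \<le> c" "c \<le> m + 2 - r"
  shows "w r c = a r c"
proof (cases "0 \<le> c")
  case True
  then show ?thesis
    using assms by (intro eq_a_right) auto
next
  case False
  interpret M: glued_2frieze m l "\<lambda>r c. a r (1 - c)" "\<lambda>r c. b r (1 - c)" "\<lambda>r c. w r (1 - c)"
    by (rule mirror)
  show ?thesis
    using M.eq_a_right[of "1 - c" r] False assms by simp
qed

lemma row_1_integral_cone:
  assumes "-m \<le> c" "c \<le> m + 1"
  shows "w 1 c \<in> \<int>"
  using eq_a[of 1 c] assms A.width a_integral by simp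

text \<open>The last term of the mirrored recurrence has coefficient 1, so it is found without
  division. This moves integrality up and to the right along a diagonal.\<close>

lemma backward_integral:
  assumes "3 \<le> r" "r \<le> m + l + 4"
    and "w r c \<in> \<int>" "w (r - 1) (c + 1) \<in> \<int>" "w (r - 2) (c + 2) \<in> \<int>"
    and "w 1 (c - r + 1) \<in> \<int>" "w 1 (c - r + 2) \<in> \<int>"
  shows "w (r - 3) (c + 3) \<in> \<int>"
proof -
  have "w (r - 3) (c + 3) = w r c - w 1 (c - r + 1) * w (r - 1) (c + 1)
      + w 1 (c - r + 2) * w (r - 2) (c + 2)"
    using W.recurrence_mirror[of r c] assms(1,2) by (simp add: algebra_simps)
  then show ?thesis
    using assms by simp
qed

text \<open>Row \<open>m + 1\<close> is the seam; its entries in columns \<open>0\<close> and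
  \<open>1\<close> are 1, so the local rule gives the next entry without division.\<close>

lemma seam_2: "w (m + 1) 2 = 1 + a m 1 * b 1 1"
proof -
  have "w (m + 1) 1 = w (m + 1) 0 * w (m + 1) 2 - w m 1 * w (m + 2) 1"
    using W.rule[of "m + 1" 1] A.width B.width by (simp add: algebra_simps)
  then show ?thesis
    using glue_a[of "m + 1" 0] glue_a[of "m + 1" 1] glue_a[of m 1] glue_b[of 1 1]
      A.width B.width by (simp add: A.bottom' algebra_simps)
qed

lemma seam_3_integral: "w (m + 1) 3 \<in> \<int>"
proof -
  interpret F: glued_2frieze l m "\<lambda>r c. b (l + 1 - r) c" "\<lambda>r c. a (m + 1 - r) c"
    "\<lambda>r c. w (m + l + 2 - r) c"
    by (rule flip)
  have "w (m + 1) 2 = w (m + 1) 1 * w (m + 1) 3 - w m 2 * w (m + 2) 2"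
    using W.rule[of "m + 1" 2] A.width B.width by (simp add: algebra_simps)
  moreover have "w m 2 = a m 2"
    using eq_a[of m 2] A.width by simp
  \<comment> \<open>Row \<open>m + 2\<close> is row \<open>l\<close> of the flipped frieze, and
    column \<open>2\<close> is still in its domain of dependence.\<close>
  moreover have "w (m + 2) 2 = b 1 2"
    using F.eq_a[of l 2] B.width by simp
  ultimately have "w (m + 1) 3 = 1 + a m 1 * b 1 1 + a m 2 * b 1 2"
    using glue_a[of "m + 1" 1] A.width seam_2 by (simp add: A.bottom' algebra_simps)
  then show ?thesis
    by (simp add: a_integral b_integral)
qed

text \<open>Here the local rule divides by \<open>a m 1\<close>. Comparison with the same rule in
  \<open>a\<close> shows that the numerator is a multiple of it:
  \<open>w m 3 = a m 3 + a (m - 1) 2 * b 1 1\<close> for positive \<open>m\<close>.\<close>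

lemma above_seam_3_integral: "w m 3 \<in> \<int>"
proof (cases "m = 0")
  case False
  then have m: "1 \<le> m"
    using A.width by simp
  have "w m 2 = w m 1 * w m 3 - w (m - 1) 2 * w (m + 1) 2"
    using W.rule[of m 2] m B.width by (simp add: algebra_simps)
  moreover have "w m 2 = a m 2" "w m 1 = a m 1" "w (m - 1) 2 = a (m - 1) 2"
    using eq_a[of m 2] eq_a[of m 1] eq_a[of "m - 1" 2] m by simp_all
  moreover have "a m 2 = a m 1 * a m 3 - a (m - 1) 2"
    using A.rule[of m 2] m by (simp add: A.bottom)
  ultimately have "a m 1 * w m 3 = a m 1 * (a m 3 + a (m - 1) 2 * b 1 1)"
    using seam_2 by (simp add: algebra_simps)
  moreover have "a m 1 \<noteq> 0"
    using A.pos[of m 1] m by simp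
  ultimately show ?thesis
    by (simp add: a_integral b_integral)
qed (simp add: W.top)

text \<open>This entry lies just outside the domain of dependence. It is reached on the diagonal
  \<open>r + c = m + 3\<close>, starting from the three integers \<open>w (m + 2) 1\<close>,
  \<open>w (m + 1) 2\<close>, \<open>w m 3\<close> around the seam.\<close>

lemma row_1_integral_right_1: "w 1 (m + 2) \<in> \<int>"
proof -
  have "k \<le> m \<longrightarrow> w (m + 2 - k) (k + 1) \<in> \<int> \<and> w (m + 1 - k) (k + 2) \<in> \<int> \<and> w (m - k) (k + 3) \<in> \<int>"
    if "0 \<le> k" for k
    using that
  proof (induction k rule: int_ge_induct)
    case base
    have "w (m + 2) 1 \<in> \<int>"
      using glue_b[of 1 1] B.width b_integral by (simp add: add.commute)
    then show ?case
      using seam_2 above_seam_3_integral by (simp add: a_integral b_integral)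
  next
    case (step k)
    show ?case
    proof
      assume k: "k + 1 \<le> m"
      \<comment> \<open>The coefficients lie in columns \<open>2 * k - m\<close> and
        \<open>2 * k - m + 1\<close> of row \<open>1\<close>, inside the cone since
        \<open>k < m\<close>.\<close>
      have "w (m + 2 - k - 3) (k + 1 + 3) \<in> \<int>"
        using step k B.width
        by (intro backward_integral row_1_integral_cone) (auto simp: algebra_simps)
      then show "w (m + 2 - (k + 1)) (k + 1 + 1) \<in> \<int> \<and> w (m + 1 - (k + 1)) (k + 1 + 2) \<in> \<int>
          \<and> w (m - (k + 1)) (k + 1 + 3) \<in> \<int>"
        using step k by (auto simp: algebra_simps)
    qed
  qed
  from this[of m] show ?thesis
    using A.width by (simp add: algebra_simps)
qed

lemma row_1_integral_left_1: "w 1 (- m - 1) \<in> \<int>"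
proof -
  interpret M: glued_2frieze m l "\<lambda>r c. a r (1 - c)" "\<lambda>r c. b r (1 - c)" "\<lambda>r c. w r (1 - c)"
    by (rule mirror)
  show ?thesis
    using M.row_1_integral_right_1 by (simp add: minus_diff_commute)
qed

lemma row_1_integral_middle:
  assumes "- m - 1 \<le> c" "c \<le> m + 2"
  shows "w 1 c \<in> \<int>"
proof -
  consider "c = - m - 1" | "-m \<le> c" "c \<le> m + 1" | "c = m + 2"
    using assms by linarith
  then show ?thesis
    using row_1_integral_cone row_1_integral_left_1 row_1_integral_right_1 by cases auto
qed

text \<open>The same walk on the next diagonal, \<open>r + c = m + 4\<close>, from
  \<open>w (m + 3) 1\<close>, \<open>w (m + 2) 2\<close>, \<open>w (m + 1) 3\<close>.\<close>

lemma row_1_integral_right_2: "w 1 (m + 3) \<in> \<int>"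
proof -
  interpret F: glued_2frieze l m "\<lambda>r c. b (l + 1 - r) c" "\<lambda>r c. a (m + 1 - r) c"
    "\<lambda>r c. w (m + l + 2 - r) c"
    by (rule flip)
  have "k \<le> m + 1 \<longrightarrow> w (m + 3 - k) (k + 1) \<in> \<int> \<and> w (m + 2 - k) (k + 2) \<in> \<int> \<and> w (m + 1 - k) (k + 3) \<in> \<int>"
    if "0 \<le> k" for k
    using that
  proof (induction k rule: int_ge_induct)
    case base
    have "w (m + 3) 1 \<in> \<int>"
    \<comment> \<open>For \<open>l = 0\<close> the row \<open>m + 3\<close> is already the first
      zero row below the frieze.\<close>
    proof (cases "l = 0")
      case True
      then show ?thesis
        using W.zero_below(1)[of 1] by (simp add: algebra_simps)
    next
      case False
      then show ?thesis
        using glue_b[of 2 1] B.width b_integral by (simp add: algebra_simps)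
    qed
    moreover have "w (m + 2) 2 \<in> \<int>"
      using F.eq_a[of l 2] B.width b_integral by simp
    ultimately show ?case
      using seam_3_integral by simp
  next
    case (step k)
    show ?case
    proof
      assume k: "k + 1 \<le> m + 1"
      \<comment> \<open>The coefficients now lie in columns \<open>2 * k - m - 1\<close> and
        \<open>2 * k - m\<close>. At \<open>k = 0\<close> this includes \<open>- m - 1\<close>,
        which is why the entry to the left of the cone had to be settled first.\<close>
      have "w (m + 3 - k - 3) (k + 1 + 3) \<in> \<int>"
        using step k B.width
        by (intro backward_integral row_1_integral_middle) (auto simp: algebra_simps)
      then show "w (m + 3 - (k + 1)) (k + 1 + 1) \<in> \<int> \<and> w (m + 2 - (k + 1)) (k + 1 + 2) \<in> \<int>
          \<and> w (m + 1 - (k + 1)) (k + 1 + 3) \<in> \<int>"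
        using step k by (auto simp: algebra_simps)
    qed
  qed
  from this[of "m + 1"] show ?thesis
    using A.width by (simp add: algebra_simps)
qed

lemma row_1_integral_near:
  assumes "- m - 1 \<le> c" "c \<le> m + 3"
  shows "w 1 c \<in> \<int>"
  using row_1_integral_middle[of c] row_1_integral_right_2 assms by (cases "c = m + 3") auto

text \<open>The known integers are \<open>2 * m + 5\<close> consecutive entries of row
  \<open>1\<close> and, by flipping, \<open>2 * l + 5\<close> of row \<open>m + l + 1\<close>. The
  glide places the second block directly after the first, and together they fill exactly one period
  \<open>2 * (m + l + 5)\<close>.\<close>

theorem integral:
  assumes "0 \<le> r" "r \<le> m + l + 2"
  shows "w r c \<in> \<int>"
proof (rule W.integral_if_period_integral[of "- m - 1"])
  interpret F: glued_2frieze l m "\<lambda>r c. b (l + 1 - r) c" "\<lambda>r c. a (m + 1 - r) c"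
    "\<lambda>r c. w (m + l + 2 - r) c"
    by (rule flip)
  fix c :: int
  assume c: "- m - 1 \<le> c" "c < - m - 1 + 2 * (m + l + 1 + 4)"
  show "w 1 c \<in> \<int>"
  proof (cases "c \<le> m + 3")
    case True
    then show ?thesis
      using c row_1_integral_near by simp
  next
    case False
    \<comment> \<open>The remaining columns, from \<open>m + 4\<close> on, are carried to the
      interval from \<open>- l - 1\<close> to \<open>l + 3\<close> in the bottom inner row.\<close>
    have "w 1 c = w (m + l + 1) (c - (m + l + 5))"
      using W.glide[of "c - (m + l + 5)"] by (simp add: algebra_simps)
    also have "\<dots> \<in> \<int>"
      using F.row_1_integral_near[of "c - (m + l + 5)"] c False by (simp add: algebra_simps)
    finally show ?thesis .
  qed
qed (use assms in auto)

end

section \<open>Positive 2-friezes generated by two consecutive columns\<close>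

definition frieze_column :: "int \<Rightarrow> (int \<Rightarrow> 'a::linordered_field) \<Rightarrow> bool" where
  "frieze_column n u \<longleftrightarrow> u 0 = 1 \<and> u (n + 1) = 1 \<and>
     (\<forall>r. if 0 \<le> r \<and> r \<le> n + 1 then 0 < u r else u r = 0)"

text \<open>The local rule solved for its right-hand entry; copying \<open>u\<close> in the other
  rows preserves the ones and the zeros.\<close>

definition next_column :: "int \<Rightarrow> (int \<Rightarrow> 'a::linordered_field) \<Rightarrow> (int \<Rightarrow> 'a) \<Rightarrow> int \<Rightarrow> 'a" where
  "next_column n u v r = (if 1 \<le> r \<and> r \<le> n then (v r + v (r - 1) * v (r + 1)) / u r else u r)"

fun columns :: "int \<Rightarrow> (int \<Rightarrow> 'a::linordered_field) \<Rightarrow> (int \<Rightarrow> 'a) \<Rightarrow> nat \<Rightarrow> int \<Rightarrow> 'a" where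
  "columns n u v 0 = u"
| "columns n u v (Suc 0) = v"
| "columns n u v (Suc (Suc k)) = next_column n (columns n u v k) (columns n u v (Suc k))"

lemma frieze_column_pos: "\<lbrakk>frieze_column n u; 0 \<le> r; r \<le> n + 1\<rbrakk> \<Longrightarrow> 0 < u r"
  unfolding frieze_column_def by metis

lemma frieze_column_next:
  assumes "frieze_column n u" "frieze_column n v"
  shows "frieze_column n (next_column n u v)"
proof -
  have "0 < (v r + v (r - 1) * v (r + 1)) / u r" if "1 \<le> r" "r \<le> n" for r
    using that assms by (intro divide_pos_pos add_pos_pos mult_pos_pos frieze_column_pos) auto
  then show ?thesis
    using assms(1) by (auto simp: frieze_column_def next_column_def)
qed

lemma frieze_column_columns:
  assumes "frieze_column n u" "frieze_column n v"
  shows "frieze_column n (columns n u v k)"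
  using assms by (induction n u v k rule: columns.induct) (auto intro: frieze_column_next)

lemma columns_rule:
  assumes "frieze_column n u" "frieze_column n v" "1 \<le> r" "r \<le> n"
  shows "columns n u v (Suc k) r = columns n u v k r * columns n u v (Suc (Suc k)) r
           - columns n u v (Suc k) (r - 1) * columns n u v (Suc k) (r + 1)"
proof -
  have "columns n u v k r \<noteq> 0"
    using frieze_column_pos[OF frieze_column_columns[OF assms(1,2)], of r k] assms(3,4) by simp
  then show ?thesis
    using assms(3,4) by (simp add: next_column_def)
qed

text \<open>The local rule is invariant under reversing the columns, so the left half is generated
  by the same process with \<open>u\<close> and \<open>v\<close> exchanged.\<close>

lemma positive_2frieze_of_columns:
  fixes u v :: "int \<Rightarrow> 'a::linordered_field"
  assumes "0 \<le> n" and uv: "frieze_column n u" "frieze_column n v"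
  obtains w where "positive_2frieze n w" "\<And>r. w r 0 = u r" "\<And>r. w r 1 = v r"
proof
  define w where
    "w r c = (if 0 \<le> c then columns n u v (nat c) r else columns n v u (nat (1 - c)) r)" for r c
  \<comment> \<open>The two halves overlap in columns \<open>0\<close> and \<open>1\<close>, so the
    leftward description also covers the rule centred at column \<open>0\<close>.\<close>
  have w_left: "w r c = columns n v u (nat (1 - c)) r" if "c \<le> 1" for r c
  proof -
    have "c = 0 \<or> c = 1 \<or> c < 0"
      using that by auto
    then show ?thesis
      by (auto simp: w_def)
  qed
  have col: "frieze_column n (\<lambda>r. w r c)" for c
    using uv by (cases "0 \<le> c") (simp_all add: w_def frieze_column_columns)
  show "positive_2frieze n w"
  proof
    fix r c :: int
    assume r: "1 \<le> r" "r \<le> n"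
    show "w r c = w r (c - 1) * w r (c + 1) - w (r - 1) c * w (r + 1) c"
    proof (cases "1 \<le> c")
      case True
      then have "nat c = Suc (nat (c - 1))" "nat (c + 1) = Suc (Suc (nat (c - 1)))"
        by simp_all
      then show ?thesis
        using columns_rule[OF uv r, of "nat (c - 1)"] True by (simp only: w_def) simp
    next
      case False
      then have "nat (1 - c) = Suc (nat (- c))" "nat (1 - (c - 1)) = Suc (Suc (nat (- c)))"
        "nat (1 - (c + 1)) = nat (- c)"
        by simp_all
      moreover have "c - 1 \<le> 1" "c \<le> 1" "c + 1 \<le> 1"
        using False by simp_all
      ultimately show ?thesis
        using columns_rule[OF uv(2,1) r, of "nat (- c)"]
        by (simp only: w_left mult.commute[of "columns n v u (Suc (Suc (nat (- c)))) r"])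
    qed
  next
    show "w 0 c = 1" "w (n + 1) c = 1" "w (-1) c = 0" "w (-2) c = 0" "w (n + 2) c = 0"
      "w (n + 3) c = 0" for c
      using col[of c] \<open>0 \<le> n\<close> by (simp_all add: frieze_column_def)
    show "0 < w r c" if "0 \<le> r" "r \<le> n + 1" for r c
      using frieze_column_pos[OF col] that .
  qed fact
  show "w r 0 = u r" "w r 1 = v r" for r
    by (simp_all add: w_def)
qed

section \<open>Passage between integer and rational friezes, and the gluing itself\<close>

definition extend_by_zeros :: "nat \<Rightarrow> (nat \<Rightarrow> int \<Rightarrow> int) \<Rightarrow> int \<Rightarrow> int \<Rightarrow> rat" where
  "extend_by_zeros n a r c = (if 0 \<le> r \<and> r \<le> int n + 1 then of_int (a (nat r) c) else 0)"

text \<open>Rational values allow the divisions that generate columns; the shift by \<open>k\<close>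
  brings the chosen pair of columns to \<open>0\<close> and \<open>1\<close>.\<close>

lemma positive_2frieze_extend_by_zeros:
  assumes "integral_closed_2frieze n a"
  shows "positive_2frieze (int n) (\<lambda>r c. extend_by_zeros n a r (k + c))"
proof
  have a_rule: "a r c = a r (c - 1) * a r (c + 1) - a (r - 1) c * a (r + 1) c" if "1 \<le> r" "r \<le> n" for r c
    using assms that unfolding integral_closed_2frieze_def closed_2frieze_def by blast
  have a_boundary: "a 0 c = 1" "a (n + 1) c = 1" and a_pos: "r \<le> n + 1 \<Longrightarrow> 0 < a r c" for r c
    using assms unfolding integral_closed_2frieze_def closed_2frieze_def by blast+
  fix r c :: int
  show "extend_by_zeros n a r (k + c) = extend_by_zeros n a r (k + (c - 1)) * extend_by_zeros n a r (k + (c + 1))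
      - extend_by_zeros n a (r - 1) (k + c) * extend_by_zeros n a (r + 1) (k + c)"
    if r: "1 \<le> r" "r \<le> int n"
  proof -
    have "nat (r - 1) = nat r - 1" "nat (r + 1) = nat r + 1"
      using r by simp_all
    moreover have "(of_int (a (nat r) (k + c)) :: rat) = of_int (a (nat r) (k + c - 1) * a (nat r) (k + c + 1)
        - a (nat r - 1) (k + c) * a (nat r + 1) (k + c))"
      using a_rule[of "nat r" "k + c"] r by (simp add: nat_le_iff)
    ultimately show ?thesis
      using r by (simp add: extend_by_zeros_def add_diff_eq add.assoc)
  qed
  show "0 < extend_by_zeros n a r (k + c)" if "0 \<le> r" "r \<le> int n + 1"
    using a_pos that by (simp add: extend_by_zeros_def nat_le_iff)
  have "nat (int n + 1) = n + 1"
    by simp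
  then show "extend_by_zeros n a (int n + 1) (k + c) = 1"
    using a_boundary(2) by (simp add: extend_by_zeros_def)
  show "extend_by_zeros n a 0 (k + c) = 1"
    using a_boundary(1) by (simp add: extend_by_zeros_def)
qed (simp_all add: extend_by_zeros_def)

lemma integral_closed_2frieze_floor:
  assumes "positive_2frieze (int n) w" and "\<And>r c. \<lbrakk>0 \<le> r; r \<le> int n + 1\<rbrakk> \<Longrightarrow> w r c \<in> \<int>"
  shows "integral_closed_2frieze n (\<lambda>r c. \<lfloor>w (int r) c :: rat\<rfloor>)"
proof -
  interpret positive_2frieze "int n" w
    by fact
  have floor: "of_int \<lfloor>w r c\<rfloor> = w r c" if "0 \<le> r" "r \<le> int n + 1" for r c
    using assms(2)[OF that] by simp
  have "\<lfloor>w (int r) c\<rfloor> = \<lfloor>w (int r) (c - 1)\<rfloor> * \<lfloor>w (int r) (c + 1)\<rfloor>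
      - \<lfloor>w (int (r - 1)) c\<rfloor> * \<lfloor>w (int (r + 1)) c\<rfloor>" if r: "1 \<le> r" "r \<le> n" for r c
  proof -
    have "(of_int \<lfloor>w (int r) c\<rfloor> :: rat) = of_int (\<lfloor>w (int r) (c - 1)\<rfloor> * \<lfloor>w (int r) (c + 1)\<rfloor>
      - \<lfloor>w (int r - 1) c\<rfloor> * \<lfloor>w (int r + 1) c\<rfloor>)"
      unfolding of_int_diff of_int_mult using r
      by (subst (1 2 3 4 5) floor) (auto intro: inner_rule)
    then show ?thesis
      using r by (simp only: of_int_eq_iff) (simp add: of_nat_diff add.commute)
  qed
  moreover have "\<lfloor>w (int (n + 1)) c\<rfloor> = 1" "\<lfloor>w (int 0) c\<rfloor> = 1" for c
    using bottom[of c] top[of c] by (simp_all add: add.commute)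
  moreover have "0 < \<lfloor>w (int r) c\<rfloor>" if "r \<le> n + 1" for r c
  proof -
    have "(0::rat) < of_int \<lfloor>w (int r) c\<rfloor>"
      using pos[of "int r" c] that by (subst floor) simp_all
    then show ?thesis
      by (simp only: of_int_0_less_iff)
  qed
  ultimately show ?thesis
    unfolding integral_closed_2frieze_def closed_2frieze_def by blast
qed

theorem theorem2:
  fixes m l :: nat and a b :: "nat \<Rightarrow> int \<Rightarrow> int" and c d :: int
  assumes "integral_closed_2frieze m a"
    and "integral_closed_2frieze l b"
  shows "\<exists>w. integral_closed_2frieze (m + l + 1) w \<and>
           (\<forall>e\<in>{0, 1}.
              (\<forall>r. r \<le> m + 1 \<longrightarrow> w r e = a r (c + e)) \<and>
              (\<forall>r. r \<le> l + 1 \<longrightarrow> w (m + 1 + r) e = b r (d + e)))"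
proof -
  define A where "A r e = extend_by_zeros m a r (c + e)" for r e
  define B where "B r e = extend_by_zeros l b r (d + e)" for r e
  interpret A: positive_2frieze "int m" A
    unfolding A_def by (rule positive_2frieze_extend_by_zeros) fact
  interpret B: positive_2frieze "int l" B
    unfolding B_def by (rule positive_2frieze_extend_by_zeros) fact
  \<comment> \<open>The glued columns for \<open>e = 0\<close> and \<open>e = 1\<close>. The seam
    row \<open>m + 1\<close> is read from \<open>A\<close>; it agrees with the top row of
    \<open>B\<close>, both being 1.\<close>
  define u where "u e r = (if r \<le> int m + 1 then A r e else B (r - int m - 1) e)" for e r
  have A_outside: "A r e = 0" if "r < 0" for r e
    using that by (simp add: A_def extend_by_zeros_def)
  have B_outside: "B r e = 0" if "r > int l + 1" for r e
    using that by (simp add: B_def extend_by_zeros_def)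
  have column: "frieze_column (int m + int l + 1) (u e)" for e
    unfolding frieze_column_def
  proof (intro conjI allI)
    show "if 0 \<le> r \<and> r \<le> int m + int l + 1 + 1 then 0 < u e r else u e r = 0" for r
      using A.pos[of r e] B.pos[of "r - int m - 1" e] by (auto simp: u_def A_outside B_outside)
    show "u e 0 = 1"
      by (simp add: u_def A.top)
    show "u e (int m + int l + 1 + 1) = 1"
      using B.bottom[of e] B.width by (simp add: u_def add.commute)
  qed
  obtain w where w: "positive_2frieze (int m + int l + 1) w"
      and w_0: "\<And>r. w r 0 = u 0 r" and w_1: "\<And>r. w r 1 = u 1 r"
    using positive_2frieze_of_columns[OF _ column[of 0] column[of 1]] by auto
  have w_a: "w r e = A r e" if "r \<le> int m + 1" "e \<in> {0, 1}" for r e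
    using that w_0 w_1 by (auto simp: u_def)
  have w_b: "w (int m + 1 + r) e = B r e" if "0 \<le> r" "e \<in> {0, 1}" for r e
  proof (cases "r = 0")
    case True
    then show ?thesis
      using w_a[of "int m + 1" e] that True by (simp add: A.bottom B.top)
  next
    case False
    then show ?thesis
      using that w_0 w_1 by (auto simp: u_def)
  qed
  interpret glued_2frieze "int m" "int l" A B w
  proof (intro glued_2frieze.intro A.positive_2frieze_axioms B.positive_2frieze_axioms w
      glued_2frieze_axioms.intro)
    show "A r e \<in> \<int>" "B r e \<in> \<int>" for r e
      by (simp_all add: A_def B_def extend_by_zeros_def)
  qed (use w_a w_b in auto)
  have "integral_closed_2frieze (m + l + 1) (\<lambda>r e. \<lfloor>w (int r) e\<rfloor>)"
    by (rule integral_closed_2frieze_floor) (use w integral in \<open>simp_all add: add_ac\<close>)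
  moreover have "\<lfloor>w (int r) e\<rfloor> = a r (c + e)" if "r \<le> m + 1" "e \<in> {0, 1}" for r e
    using w_a[of "int r" e] that by (simp add: A_def extend_by_zeros_def)
  moreover have "\<lfloor>w (int (m + 1 + r)) e\<rfloor> = b r (d + e)" if "r \<le> l + 1" "e \<in> {0, 1}" for r e
  proof -
    have "int (m + 1 + r) = int m + 1 + int r"
      by simp
    then show ?thesis
      using w_b[of "int r" e] that by (simp only:) (simp add: B_def extend_by_zeros_def)
  qed
  ultimately show ?thesis
    by blast
qed

end
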